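(* Let $\mathcal{M}$ be a positroid on $[n]$ without loops or coloops, with associated (fixed-point-free) decorated permutation $\pi$, and let $E\subseteq[n]$ be a cyclic interval. Then $E$ is a flat of $\mathcal{M}$ if and only if its complement $E^c=[n]\setminus E$ is covered by CCW-arrows of $\pi$.
   Context: A positroid of rank $d$ on $[n]=\{1,\dots,n\}$ is a matroid whose bases are the column sets of the nonzero maximal minors of some real $d\times n$ matrix of rank $d$ all of whose maximal minors are nonnegative. The cyclically shifted order $<_i$ on $[n]$ is $i<_i i+1<_i\cdots<_i n<_i 1<_i\cdots<_i i-1$. For $a,b\in[n]$ the cyclic interval is $[a,b]=\{x\in[n]: x\le_a b\}$ (nonempty; $[a,a-1]=[n]$, indices mod $n$). Decorated permutation of a loopless and coloopless positroid $\mathcal{M}$ with rank function $\operatorname{rk}$: it is the permutation $\pi$ of $[n]$ (without fixed points) for which $\pi(i)$ is the first element $j$ in the list $i+1,i+2,\dots,i-1$ (cyclically) such that $\operatorname{rk}(\{i,i+1,\dots,j\})=\operatorname{rk}(\{i+1,\dots,j\})$. A CCW-arrow of $\pi$ is a cyclic interval of the form $[x,\pi^{-1}(x)]$, $x\in[n]$. A set $S\subseteq[n]$ is covered by CCW-arrows of $\pi$ if each element of $S$ is contained in some CCW-arrow of $\pi$ that is itself contained in $S$ (vacuously true for $S=\emptyset$). *)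

theory Defs
  imports "Jordan_Normal_Form.DL_Rank_Submatrix"
begin

text \<open>A matroid is given by its ground set and its family of bases.\<close>

definition matroid :: "'a set \<Rightarrow> 'a set set \<Rightarrow> bool" where
  "matroid X \<B> \<longleftrightarrow> finite X \<and> \<B> \<noteq> {} \<and> (\<forall>B\<in>\<B>. B \<subseteq> X) \<and>
     (\<forall>B\<in>\<B>. \<forall>B'\<in>\<B>. \<forall>x\<in>B - B'. \<exists>y\<in>B' - B. insert y (B - {x}) \<in> \<B>)"

definition indep :: "'a set set \<Rightarrow> 'a set \<Rightarrow> bool" where
  "indep \<B> I \<longleftrightarrow> (\<exists>B\<in>\<B>. I \<subseteq> B)"

definition rk :: "'a set set \<Rightarrow> 'a set \<Rightarrow> nat" where
  "rk \<B> S = Max (card ` {I. I \<subseteq> S \<and> indep \<B> I})"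

definition flat :: "'a set \<Rightarrow> 'a set set \<Rightarrow> 'a set \<Rightarrow> bool" where
  "flat X \<B> F \<longleftrightarrow> F \<subseteq> X \<and> (\<forall>x\<in>X - F. rk \<B> F < rk \<B> (insert x F))"

definition loopless :: "'a set \<Rightarrow> 'a set set \<Rightarrow> bool" where
  "loopless X \<B> \<longleftrightarrow> (\<forall>x\<in>X. \<exists>B\<in>\<B>. x \<in> B)"

definition coloopless :: "'a set \<Rightarrow> 'a set set \<Rightarrow> bool" where
  "coloopless X \<B> \<longleftrightarrow> (\<forall>x\<in>X. \<exists>B\<in>\<B>. x \<notin> B)"

text \<open>The ground set is \<open>{1..n}\<close>, while matrix columns are numbered from \<open>0\<close>: the
  element \<open>j\<close> is column \<open>j - 1\<close>, so the column set of \<open>I\<close> is \<open>Suc -` I\<close>.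
  The operation \<open>submatrix\<close> lists the selected columns in increasing order.\<close>

definition maximal_minor :: "real mat \<Rightarrow> nat set \<Rightarrow> real" where
  "maximal_minor A I = det (submatrix A UNIV (Suc -` I))"

definition positroid :: "nat \<Rightarrow> nat set set \<Rightarrow> bool" where
  "positroid n \<B> \<longleftrightarrow> matroid {1..n} \<B> \<and>
     (\<exists>d. \<exists>A \<in> carrier_mat d n. vec_space.rank d A = d \<and>
        (\<forall>I. I \<subseteq> {1..n} \<and> card I = d \<longrightarrow> maximal_minor A I \<ge> 0) \<and>
        \<B> = {I. I \<subseteq> {1..n} \<and> card I = d \<and> maximal_minor A I \<noteq> 0})"

text \<open>For \<open>a\<close> and \<open>x\<close> in \<open>{1..n}\<close>, \<open>cyc_pos n a x\<close> is the position (from \<open>0\<close>) of \<open>x\<close> in the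
  list \<open>a, a+1, \<dots>, n, 1, \<dots>, a-1\<close>; the shifted order \<open>\<le>\<^sub>a\<close> compares these positions.\<close>

definition cyc_pos :: "nat \<Rightarrow> nat \<Rightarrow> nat \<Rightarrow> nat" where
  "cyc_pos n a x = (x + n - a) mod n"

definition cyc_le :: "nat \<Rightarrow> nat \<Rightarrow> nat \<Rightarrow> nat \<Rightarrow> bool" where
  "cyc_le n a x y \<longleftrightarrow> cyc_pos n a x \<le> cyc_pos n a y"

definition cyc_interval :: "nat \<Rightarrow> nat \<Rightarrow> nat \<Rightarrow> nat set" where
  "cyc_interval n a b = {x \<in> {1..n}. cyc_le n a x b}"

definition is_cyc_interval :: "nat \<Rightarrow> nat set \<Rightarrow> bool" where
  "is_cyc_interval n E \<longleftrightarrow> (\<exists>a\<in>{1..n}. \<exists>b\<in>{1..n}. E = cyc_interval n a b)"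

definition cyc_succ :: "nat \<Rightarrow> nat \<Rightarrow> nat" where
  "cyc_succ n i = (if i = n then 1 else Suc i)"

text \<open>The elements of \<open>{1..n} - {i}\<close>, sorted by \<open>cyc_pos n i\<close>, form the list
  \<open>i+1, i+2, \<dots>, i-1\<close>. If there are no coloops then \<open>j = i-1\<close> satisfies the rank condition,
  so the minimum exists; it is unique because \<open>cyc_pos n i\<close> is injective on \<open>{1..n}\<close>.
  Outside \<open>{1..n}\<close> the map is the identity, as in the convention of \<open>permutes\<close>.\<close>

definition decorated_perm :: "nat \<Rightarrow> nat set set \<Rightarrow> nat \<Rightarrow> nat" where
  "decorated_perm n \<B> i =
     (if i \<in> {1..n} then
        (ARG_MIN (cyc_pos n i) j. j \<in> {1..n} - {i} \<and>
           rk \<B> (cyc_interval n i j) = rk \<B> (cyc_interval n (cyc_succ n i) j))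
      else i)"

definition ccw_arrow :: "nat \<Rightarrow> (nat \<Rightarrow> nat) \<Rightarrow> nat set \<Rightarrow> bool" where
  "ccw_arrow n \<pi> A \<longleftrightarrow> (\<exists>x\<in>{1..n}. A = cyc_interval n x (inv_into {1..n} \<pi> x))"

definition covered_by_ccw_arrows :: "nat \<Rightarrow> (nat \<Rightarrow> nat) \<Rightarrow> nat set \<Rightarrow> bool" where
  "covered_by_ccw_arrows n \<pi> S \<longleftrightarrow> (\<forall>s\<in>S. \<exists>A. ccw_arrow n \<pi> A \<and> s \<in> A \<and> A \<subseteq> S)"

end

theory Submission
  imports Defs
begin

text \<open>Call \<open>x\<close> and \<open>y\<close> parallel over \<open>F\<close> if they are parallel non-loops of the contraction by
  \<open>F\<close>. The permutation satisfies \<open>\<pi> y = x\<close> exactly when \<open>x\<close> and \<open>y\<close> are parallel over the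
  complement of \<open>[x, y]\<close>. If \<open>E\<close> is flat and \<open>s \<notin> E\<close>, a maximal cyclic interval \<open>F \<supseteq> E\<close> that does
  not span \<open>s\<close> has neighbours \<open>x\<close> and \<open>y\<close> that are parallel over \<open>F\<close>, so the complement of
  \<open>F\<close> is an arrow containing \<open>s\<close>; this holds in every matroid. Conversely, if \<open>s\<close> lies in an arrow
  \<open>[x, y]\<close> with complement \<open>F \<supseteq> E\<close> and is spanned by \<open>F\<close>, then there is \<open>f \<in> F\<close> such that
  in a contraction of rank two \<open>s\<close> and \<open>f\<close> are parallel to each other but to neither of \<open>x\<close> and
  \<open>y\<close>. As \<open>{x, y}\<close> and \<open>{s, f}\<close> cross, this contradicts a three-term Pluecker relation
  between nonnegative minors.\<close>

section \<open>Pluecker relations for sorted minors\<close>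

text \<open>The list length doubles as the dimension, so a vector contributes only its first
  \<open>length cs\<close> coordinates and columns can be rearranged by list operations.\<close>

definition cols_det :: "'a::comm_ring_1 vec list \<Rightarrow> 'a" where
  "cols_det cs = det (mat_of_cols (length cs) cs)"

lemma cols_det_not_distinct:
  assumes "\<not> distinct cs" shows "cols_det cs = 0"
proof -
  obtain i j where "i < length cs" "j < length cs" "i \<noteq> j" "cs ! i = cs ! j"
    using assms by (auto simp: distinct_conv_nth)
  then show ?thesis unfolding cols_det_def
    by (intro det_identical_columns[of _ "length cs" i j]) (auto simp: mat_of_cols_def col_def)
qed

lemma cols_det_swap:
  "cols_det (us @ v # w # ws) = - cols_det (us @ w # v # ws)"
proof -
  let ?k = "length us" and ?n = "length us + length ws + 2"
  have "mat_of_cols ?n (us @ v # w # ws) = swapcols ?k (Suc ?k) (mat_of_cols ?n (us @ w # v # ws))"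
    by (rule eq_matI) (auto simp: mat_of_cols_def nth_append nth_Cons split: nat.split)
  moreover have "mat_of_cols ?n (us @ w # v # ws) \<in> carrier_mat ?n ?n" by (rule carrier_matI) auto
  ultimately show ?thesis
    using det_swapcols[of ?k ?n "Suc ?k"] by (simp add: cols_det_def)
qed

lemma cols_det_move:
  "cols_det (us @ v # ws @ zs) = (-1) ^ length ws * cols_det (us @ ws @ v # zs)"
proof (induction ws arbitrary: us)
  case (Cons w ws)
  show ?case using cols_det_swap[of us v w "ws @ zs"] Cons[of "us @ [w]"] by simp
qed simp

text \<open>Cramer's rule expresses \<open>cols_det cs\<close> times \<open>v\<close> through the
  columns of \<open>cs\<close>, with coefficients \<open>cols_det (cs[k := v])\<close>. A
  determinant with first columns \<open>us\<close> is linear in its last column; applying it to this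
  expression gives the identity. The adjugate in place of an inverse avoids division.\<close>

lemma cols_det_exchange:
  fixes cs :: "'a::comm_ring_1 vec list"
  assumes len: "length cs = Suc (length us)"
  shows "cols_det cs * cols_det (us @ [v]) =
    (\<Sum>k<length cs. cols_det (cs[k := v]) * cols_det (us @ [cs ! k]))"
proof -
  let ?n = "length cs"
  let ?M = "mat_of_cols ?n cs" and ?v = "vec ?n (\<lambda>i. v $ i)"
  \<comment> \<open>The cofactors along the last column see only \<open>us\<close>, so the same
    \<open>cf\<close> serves every last column \<open>w\<close>.\<close>
  define cf where "cf i = cofactor (mat_of_cols ?n (us @ [v])) i (length us)" for i
  have expand: "cols_det (us @ [w]) = (\<Sum>i<?n. w $ i * cf i)" for w
  proof -
    have "mat_delete (mat_of_cols ?n (us @ [w])) i (length us) =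
        mat_delete (mat_of_cols ?n (us @ [v])) i (length us)" for i
      by (rule eq_matI) (auto simp: mat_delete_def mat_of_cols_def len nth_append)
    then show ?thesis unfolding cols_det_def cf_def
      by (subst laplace_expansion_column[where n = ?n and j = "length us"])
         (auto simp: len cofactor_def mat_of_cols_def nth_append intro!: carrier_matI)
  qed
  have M: "?M \<in> carrier_mat ?n ?n" by simp
  \<comment> \<open>Cramer's rule: expanding along the replaced column gives row \<open>k\<close> of
    the adjugate applied to \<open>v\<close>.\<close>
  have replace: "cols_det (cs[k := v]) = (adj_mat ?M *\<^sub>v ?v) $ k" if k: "k < ?n" for k
  proof -
    have "mat_delete (mat_of_cols ?n (cs[k := v])) i k = mat_delete ?M i k" for i
      by (rule eq_matI) (auto simp: mat_delete_def mat_of_cols_def nth_list_update)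
    then show ?thesis unfolding cols_det_def using k
      by (subst laplace_expansion_column[where n = ?n and j = k])
         (auto simp: cofactor_def mat_of_cols_def adj_mat_def scalar_prod_def mult.commute
            lessThan_atLeast0 intro!: carrier_matI sum.cong)
  qed
  have coord: "cols_det cs * v $ i = (\<Sum>k<?n. cols_det (cs[k := v]) * cs ! k $ i)" if i: "i < ?n" for i
  proof -
    have "?M *\<^sub>v (adj_mat ?M *\<^sub>v ?v) = (?M * adj_mat ?M) *\<^sub>v ?v"
      using adj_mat(1)[OF M] by (subst assoc_mult_mat_vec) auto
    also have "\<dots> = cols_det cs \<cdot>\<^sub>v ?v"
      unfolding adj_mat(2)[OF M] cols_det_def
      by (intro eq_vecI) (auto simp: scalar_prod_def if_distrib[of "\<lambda>x. _ * x * _"] sum.delta' cong: if_cong)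
    finally have "(?M *\<^sub>v (adj_mat ?M *\<^sub>v ?v)) $ i = (cols_det cs \<cdot>\<^sub>v ?v) $ i" by simp
    moreover have "(?M *\<^sub>v (adj_mat ?M *\<^sub>v ?v)) $ i =
        (\<Sum>k<?n. cols_det (cs[k := v]) * cs ! k $ i)"
      using i adj_mat(1)[OF M] replace
      by (simp add: scalar_prod_def lessThan_atLeast0 mult.commute mat_of_cols_index)
    ultimately show ?thesis using i by simp
  qed
  have "cols_det cs * cols_det (us @ [v]) = (\<Sum>i<?n. (cols_det cs * v $ i) * cf i)"
    unfolding expand by (simp add: sum_distrib_left mult.assoc)
  also have "\<dots> = (\<Sum>i<?n. \<Sum>k<?n. cols_det (cs[k := v]) * (cs ! k $ i * cf i))"
    by (intro sum.cong refl) (simp add: coord sum_distrib_right mult.assoc)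
  also have "\<dots> = (\<Sum>k<?n. cols_det (cs[k := v]) * cols_det (us @ [cs ! k]))"
    by (subst sum.swap) (simp add: expand sum_distrib_left)
  finally show ?thesis .
qed

lemma cols_det_plucker:
  "cols_det (us @ [x, f]) * cols_det (us @ [y, s]) =
   cols_det (us @ [s, f]) * cols_det (us @ [y, x]) + cols_det (us @ [x, s]) * cols_det (us @ [y, f])"
proof -
  let ?cs = "us @ [x, f]" and ?m = "length us"
  let ?g = "\<lambda>k. cols_det (?cs[k := s]) * cols_det ((us @ [y]) @ [?cs ! k])"
  have "cols_det (us @ [x, f]) * cols_det (us @ [y, s]) = (\<Sum>k<Suc (Suc ?m). ?g k)"
    using cols_det_exchange[of ?cs "us @ [y]" s] by simp
  also have "\<dots> = (\<Sum>k<?m. ?g k) + ?g ?m + ?g (Suc ?m)" by simp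
  \<comment> \<open>Here \<open>us ! k\<close> occurs twice among the columns of the second
    factor.\<close>
  also have "(\<Sum>k<?m. ?g k) = 0"
    by (rule sum.neutral) (auto simp: cols_det_not_distinct nth_append)
  finally show ?thesis
    by (simp add: list_update_append nth_append)
qed

section \<open>Signs from sorting columns\<close>

lemma sorted_list_of_set_insert_split:
  fixes j :: "'a::linorder"
  assumes "finite S" "j \<notin> S"
  shows "sorted_list_of_set (insert j S) =
           sorted_list_of_set {i \<in> S. i < j} @ j # sorted_list_of_set {i \<in> S. j < i}"
    and "sorted_list_of_set S =
           sorted_list_of_set {i \<in> S. i < j} @ sorted_list_of_set {i \<in> S. j < i}"
proof -
  let ?less = "sorted_list_of_set {i \<in> S. i < j}" and ?greater = "sorted_list_of_set {i \<in> S. j < i}"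
  have sorted: "sorted_wrt (<) (?less @ j # ?greater)" "sorted_wrt (<) (?less @ ?greater)"
    using assms by (auto simp: sorted_wrt_append)
  have set: "set (?less @ j # ?greater) = insert j S" "set (?less @ ?greater) = S"
    using assms by (auto, metis neqE)+
  show "sorted_list_of_set (insert j S) = ?less @ j # ?greater"
    by (rule strict_sorted_equal[OF sorted(1) strict_sorted_list_of_set])
       (simp only: set set_sorted_list_of_set finite_insert assms(1))
  show "sorted_list_of_set S = ?less @ ?greater"
    by (rule strict_sorted_equal[OF sorted(2) strict_sorted_list_of_set])
       (simp only: set set_sorted_list_of_set assms(1))
qed

text \<open>The column of \<open>j\<close> leaves its sorted place and passes the columns of the
  larger elements of \<open>S\<close>, one sign each. The tail \<open>zs\<close> allows a second
  extraction.\<close>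

lemma cols_det_insert:
  fixes j :: "'b::linorder"
  assumes "finite S" "j \<notin> S"
  shows "cols_det (map c (sorted_list_of_set (insert j S)) @ zs) =
    (-1) ^ card {i \<in> S. j < i} * cols_det (map c (sorted_list_of_set S) @ c j # zs)"
  by (subst sorted_list_of_set_insert_split(1)[OF assms],
      subst sorted_list_of_set_insert_split(2)[OF assms])
     (simp add: cols_det_move)

text \<open>The sign of sorting a pair of distinct indices.\<close>

definition order_sign :: "nat \<Rightarrow> nat \<Rightarrow> 'a::comm_ring_1" where
  "order_sign i j = (if i < j then 1 else - 1)"

text \<open>Two extractions in a row. Apart from the order of the pair, the sign splits into one
  factor for \<open>i\<close> and one for \<open>j\<close>; such factors cancel in a product of
  minors that uses every index twice.\<close>

lemma cols_det_insert2:
  fixes i j :: nat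
  assumes "finite S" "i \<notin> S" "j \<notin> S" "i \<noteq> j"
  shows "cols_det (map c (sorted_list_of_set (insert i (insert j S)))) =
    (-1) ^ card {k \<in> S. i < k} * (-1) ^ card {k \<in> S. j < k} * order_sign i j *
    cols_det (map c (sorted_list_of_set S) @ [c i, c j])"
proof -
  have less: "cols_det (map c (sorted_list_of_set (insert i (insert j S)))) =
    (-1) ^ card {k \<in> S. i < k} * (-1) ^ card {k \<in> S. j < k} *
    cols_det (map c (sorted_list_of_set S) @ [c i, c j])"
    if "i < j" "i \<notin> S" "j \<notin> S" for i j
  proof -
    \<comment> \<open>The smaller index \<open>i\<close> is not among the elements that
      \<open>j\<close> has to pass.\<close>
    have "{k \<in> insert i S. j < k} = {k \<in> S. j < k}" using \<open>i < j\<close> by auto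
    then show ?thesis
      using cols_det_insert[of "insert i S" j c "[]"] cols_det_insert[of S i c "[c j]"] that assms(1)
      by (simp add: insert_commute[of i j] mult_ac)
  qed
  show ?thesis
  proof (cases "i < j")
    case True
    then show ?thesis using less[OF True] assms by (simp add: order_sign_def)
  next
    case False
    then show ?thesis using less[of j i] assms cols_det_swap[of "map c (sorted_list_of_set S)" "c i" "c j" "[]"]
      by (simp add: order_sign_def insert_commute[of i j] mult_ac)
  qed
qed

section \<open>Maximal minors as determinants of sorted column lists\<close>

lemma pick_eq_sorted_list_of_set:
  assumes "finite I" "k < card I"
  shows "pick I k = sorted_list_of_set I ! k"
proof -
  let ?L = "map (pick I) [0..<card I]"
  have "set ?L = I"
  proof -
    have inj: "inj_on (pick I) {0..<card I}"
      by (rule linorder_inj_onI) (auto dest: pick_mono_le)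
    have "set ?L \<subseteq> I" using pick_in_set_le by auto
    moreover have "card (set ?L) = card I" using card_image[OF inj] by simp
    ultimately show ?thesis using card_subset_eq[OF assms(1)] by blast
  qed
  moreover have "sorted_wrt (<) ?L" by (auto simp: sorted_wrt_iff_nth_less intro: pick_mono_le)
  ultimately have "?L = sorted_list_of_set I"
    using assms(1) strict_sorted_equal[of "sorted_list_of_set I" ?L] by simp
  then show ?thesis using assms(2) by (metis add.left_neutral diff_zero length_upt nth_map nth_upt)
qed

text \<open>\<open>submatrix\<close> enumerates columns with \<open>pick\<close>, in increasing
  order. As \<open>0\<close> is not in \<open>I\<close>, the shift from \<open>j\<close> to
  \<open>j - 1\<close> is injective and monotone on \<open>I\<close>, so the sorted list of
  \<open>I\<close> yields the same columns in the same order.\<close>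

lemma maximal_minor_cols_det:
  assumes "A \<in> carrier_mat d n" "I \<subseteq> {1..n}" "card I = d"
  shows "maximal_minor A I = cols_det (map (\<lambda>j. col A (j - 1)) (sorted_list_of_set I))"
proof -
  have fin: "finite I" using assms(2) finite_subset by blast
  have vim: "Suc -` I = (\<lambda>j. j - 1) ` I"
  proof
    show "Suc -` I \<subseteq> (\<lambda>j. j - 1) ` I" by (auto intro: rev_image_eqI)
    show "(\<lambda>j. j - 1) ` I \<subseteq> Suc -` I" using assms(2) by (auto dest!: subsetD)
  qed
  have inj: "inj_on (\<lambda>j. j - 1) I"
  proof (rule inj_onI)
    fix i j assume "i \<in> I" "j \<in> I" "i - 1 = j - 1"
    moreover from this have "1 \<le> i" "1 \<le> j" using assms(2) by auto
    ultimately show "i = j" by simp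
  qed
  have card_vim: "card (Suc -` I) = d" using assms(3) inj by (simp add: vim card_image)
  have dims: "{i. i < dim_row A \<and> i \<in> UNIV} = {..<d}" "{j. j < dim_col A \<and> j \<in> Suc -` I} = Suc -` I"
    using assms by (auto simp: carrier_matD)
  have sorted_vim: "sorted_list_of_set (Suc -` I) = map (\<lambda>j. j - 1) (sorted_list_of_set I)"
  proof (rule sorted_distinct_set_unique)
    show "sorted (map (\<lambda>j. j - 1) (sorted_list_of_set I))"
      unfolding sorted_map by (rule sorted_wrt_mono_rel[OF _ sorted_sorted_list_of_set]) simp
  qed (use fin inj in \<open>auto simp: vim distinct_map\<close>)
  have "submatrix A UNIV (Suc -` I) =
      mat_of_cols d (map (\<lambda>j. col A (j - 1)) (sorted_list_of_set I))"
  proof (rule eq_matI)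
    fix i k assume "i < dim_row (mat_of_cols d (map (\<lambda>j. col A (j - 1)) (sorted_list_of_set I)))"
      "k < dim_col (mat_of_cols d (map (\<lambda>j. col A (j - 1)) (sorted_list_of_set I)))"
    then have i: "i < d" and k: "k < d" using assms(3) fin by (auto simp: length_sorted_list_of_set)
    have "sorted_list_of_set I ! k \<in> I" using k fin assms(3)
      by (metis length_sorted_list_of_set nth_mem set_sorted_list_of_set)
    then have "sorted_list_of_set I ! k - 1 < n" using assms(2) by fastforce
    moreover have "submatrix A UNIV (Suc -` I) $$ (i, k) = A $$ (i, pick (Suc -` I) k)"
      using i k card_vim submatrix_index[of i A UNIV k "Suc -` I"] by (simp only: dims card_lessThan pick_UNIV)
    ultimately show "submatrix A UNIV (Suc -` I) $$ (i, k) =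
        mat_of_cols d (map (\<lambda>j. col A (j - 1)) (sorted_list_of_set I)) $$ (i, k)"
      using i k assms fin card_vim
      by (simp add: mat_of_cols_index pick_eq_sorted_list_of_set sorted_vim finite_vimageI)
  qed (simp_all only: dim_submatrix dims mat_of_cols_carrier length_map
      sorted_list_of_set.length_sorted_key_list_of_set card_vim card_lessThan assms(3))
  then show ?thesis using assms(3) by (simp add: maximal_minor_def cols_det_def)
qed

text \<open>The sign pattern of a three-term Pluecker relation: if \<open>{s, f}\<close> were not a basis of the
  contraction by \<open>S\<close>, two products of positive minors would be opposite to each other.\<close>

lemma positroid_crossing:
  assumes "positroid n \<B>" "distinct [x, y, s, f]" "S \<inter> {x, y, s, f} = {}"
    and bases: "insert x (insert s S) \<in> \<B>" "insert x (insert f S) \<in> \<B>"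
      "insert y (insert s S) \<in> \<B>" "insert y (insert f S) \<in> \<B>"
    and crossing: "(min x y < s \<and> s < max x y) \<noteq> (min x y < f \<and> f < max x y)"
  shows "insert s (insert f S) \<in> \<B>"
proof (rule ccontr)
  assume nb: "insert s (insert f S) \<notin> \<B>"
  obtain d A where A: "A \<in> carrier_mat d n"
    and nonneg: "\<And>I. I \<subseteq> {1..n} \<Longrightarrow> card I = d \<Longrightarrow> maximal_minor A I \<ge> 0"
    and \<B>: "\<B> = {I. I \<subseteq> {1..n} \<and> card I = d \<and> maximal_minor A I \<noteq> 0}"
    using assms(1) unfolding positroid_def by blast
  have fin: "finite S" using bases(1) finite_subset[of S "{1..n}"] unfolding \<B> by auto
  have sub: "insert i (insert j S) \<subseteq> {1..n}" "card (insert i (insert j S)) = d"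
    if "i \<in> {x, y, s, f}" "j \<in> {x, y, s, f}" "i \<noteq> j" for i j
  proof -
    show "insert i (insert j S) \<subseteq> {1..n}" using bases that unfolding \<B> by auto
    have "d = card S + 2" using bases(1) assms(2,3) fin unfolding \<B> by auto
    moreover have "i \<notin> S" "j \<notin> S" using that assms(3) by auto
    ultimately show "card (insert i (insert j S)) = d" using that(3) fin by simp
  qed
  define c where "c j = col A (j - 1)" for j
  \<comment> \<open>\<open>\<tau>\<close> is the sign of pulling one column out of its sorted place;
    \<open>\<omega>\<close> is the determinant with the pulled columns at the end, as the Pluecker
    relation has them.\<close>
  define \<tau> :: "nat \<Rightarrow> real" where "\<tau> j = (-1) ^ card {k \<in> S. j < k}" for j
  define \<omega> where "\<omega> i j = cols_det (map c (sorted_list_of_set S) @ [c i, c j])" for i j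
  have \<tau>: "\<tau> j * \<tau> j = 1" for j by (simp add: \<tau>_def flip: power_add)
  have minor: "maximal_minor A (insert i (insert j S)) = \<tau> i * \<tau> j * order_sign i j * \<omega> i j"
    if "i \<in> {x, y, s, f}" "j \<in> {x, y, s, f}" "i \<noteq> j" for i j
  proof -
    have "i \<notin> S" "j \<notin> S" using that assms(3) by auto
    then show ?thesis
      using maximal_minor_cols_det[OF A sub(1,2)[OF that]] cols_det_insert2[OF fin _ _ that(3), of c]
      by (simp add: c_def[abs_def] \<tau>_def \<omega>_def)
  qed
  have pos: "\<tau> i * \<tau> j * order_sign i j * \<omega> i j > 0"
    if "i \<in> {x, y}" "j \<in> {s, f}" for i j
  proof -
    have "i \<noteq> j" "insert i (insert j S) \<in> \<B>" using that bases assms(2) by auto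
    then have "maximal_minor A (insert i (insert j S)) > 0"
      using nonneg[of "insert i (insert j S)"] unfolding \<B> by auto
    then show ?thesis using minor[of i j] that \<open>i \<noteq> j\<close> by auto
  qed
  have "\<omega> s f = 0"
  proof -
    have "s \<noteq> f" using assms(2) by simp
    then have "maximal_minor A (insert s (insert f S)) = 0"
      using nb sub[of s f] unfolding \<B> by auto
    then have "\<tau> s * \<tau> f * order_sign s f * \<omega> s f = 0" using minor[of s f] \<open>s \<noteq> f\<close> by simp
    then show ?thesis by (auto simp: \<tau>_def order_sign_def split: if_splits)
  qed
  \<comment> \<open>The Pluecker relation loses the term with the factor
    \<open>\<omega> s f\<close>.\<close>
  then have eq: "\<omega> x f * \<omega> y s = \<omega> x s * \<omega> y f"
    unfolding \<omega>_def using cols_det_plucker[of "map c (sorted_list_of_set S)" "c x" "c f" "c y" "c s"]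
    by simp
  \<comment> \<open>\<open>order_sign x z * order_sign y z\<close> is \<open>- 1\<close> exactly
    when \<open>z\<close> lies between \<open>x\<close> and \<open>y\<close>, and by the crossing
    this holds for just one of \<open>s\<close> and \<open>f\<close>.\<close>
  have sgn: "order_sign x s * order_sign y f * order_sign x f * order_sign y s = (- 1 :: real)"
    using crossing assms(2) by (auto simp: order_sign_def split: if_splits)
  \<comment> \<open>In the product of all four minors each \<open>\<tau>\<close> occurs twice, so
    only the order signs remain, and the Pluecker relation turns the product into minus a
    square.\<close>
  have "0 < (\<tau> x * \<tau> s * order_sign x s * \<omega> x s) * (\<tau> y * \<tau> f * order_sign y f * \<omega> y f) *
      ((\<tau> x * \<tau> f * order_sign x f * \<omega> x f) * (\<tau> y * \<tau> s * order_sign y s * \<omega> y s))"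
    by (intro mult_pos_pos pos) auto
  also have "\<dots> = (\<tau> x * \<tau> x) * (\<tau> y * \<tau> y) * (\<tau> s * \<tau> s) * (\<tau> f * \<tau> f) *
      (order_sign x s * order_sign y f * order_sign x f * order_sign y s) *
      (\<omega> x f * \<omega> y s) * (\<omega> x s * \<omega> y f)"
    by (simp only: mult_ac)
  also have "\<dots> = - (\<omega> x s * \<omega> y f)\<^sup>2"
    by (simp only: \<tau> sgn eq) (simp add: power2_eq_square)
  finally show False by simp
qed

section \<open>Rank and span in a matroid\<close>

text \<open>Induction on the size of \<open>B - B'\<close>: one exchange keeps the size of
  \<open>B\<close> and brings it one element closer to \<open>B'\<close>.\<close>

lemma matroid_card_bases:
  assumes M: "matroid X \<B>" and "B \<in> \<B>" "B' \<in> \<B>"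
  shows "card B = card B'"
  using assms(2)
proof (induction "card (B - B')" arbitrary: B)
  case 0
  have fin: "finite B" using M 0(2) unfolding matroid_def by (meson finite_subset)
  then have "B \<subseteq> B'" using 0(1) by simp
  \<comment> \<open>An exchange out of \<open>B'\<close> would need an element of
    \<open>B - B'\<close>, which is empty.\<close>
  moreover have "B' - B = {}"
    using M assms(3) 0(2) \<open>B \<subseteq> B'\<close> unfolding matroid_def by blast
  ultimately show ?case by (simp add: subset_antisym)
next
  case (Suc k)
  have fin: "finite B" using M Suc(3) unfolding matroid_def by (meson finite_subset)
  obtain x where x: "x \<in> B - B'" using Suc(2) by (metis card.empty ex_in_conv nat.distinct(1))
  then obtain y where y: "y \<in> B' - B" "insert y (B - {x}) \<in> \<B>"
    using M Suc(3) assms(3) unfolding matroid_def by blast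
  have "insert y (B - {x}) - B' = (B - B') - {x}" using y by auto
  then have "card (insert y (B - {x}) - B') = k" using Suc(2) x fin by simp
  then have "card (insert y (B - {x})) = card B'" using Suc(1) y(2) by simp
  moreover have "card (insert y (B - {x})) = card B"
    using x y(1) fin card_Suc_Diff1[of B x] by (simp del: card_Diff_singleton card_Diff_insert)
  ultimately show ?case by simp
qed

lemma indep_mono: "indep \<B> J \<Longrightarrow> I \<subseteq> J \<Longrightarrow> indep \<B> I"
  unfolding indep_def by blast

lemma indep_subset: "matroid X \<B> \<Longrightarrow> indep \<B> I \<Longrightarrow> I \<subseteq> X"
  unfolding indep_def matroid_def by blast

lemma indep_finite: "matroid X \<B> \<Longrightarrow> indep \<B> I \<Longrightarrow> finite I"
  using indep_subset finite_subset unfolding matroid_def by metis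

lemma basis_indep: "B \<in> \<B> \<Longrightarrow> indep \<B> B"
  unfolding indep_def by blast

lemma indep_card_basis:
  assumes "matroid X \<B>" "indep \<B> I" "B \<in> \<B>" "card B \<le> card I"
  shows "I \<in> \<B>"
proof -
  obtain B' where B': "B' \<in> \<B>" "I \<subseteq> B'" using assms(2) unfolding indep_def by blast
  then have "card B' \<le> card I" using matroid_card_bases[OF assms(1) B'(1) assms(3)] assms(4) by simp
  then have "I = B'"
    using B' card_seteq indep_finite[OF assms(1) basis_indep] by metis
  then show ?thesis using B' by simp
qed

text \<open>Suppose that no element of \<open>J\<close> augments \<open>I\<close>. Take bases
  \<open>B\<close> above \<open>I\<close> and \<open>B'\<close> above \<open>J\<close>, with
  \<open>B'\<close> having as few elements as possible outside \<open>J \<union> B\<close>. Then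
  \<open>B' - B = J - I\<close> and \<open>B - B' \<subseteq> I - J\<close>; as bases have equal
  size, \<open>J\<close> is no larger than \<open>I\<close>.\<close>

lemma indep_augment:
  assumes M: "matroid X \<B>" and I: "indep \<B> I" and J: "indep \<B> J" and less: "card I < card J"
  shows "\<exists>x\<in>J - I. indep \<B> (insert x I)"
proof (rule ccontr)
  assume no: "\<not> ?thesis"
  obtain B where B: "B \<in> \<B>" "I \<subseteq> B" using I unfolding indep_def by blast
  have disj: "J - B = J - I"
  proof -
    have "x \<notin> B" if "x \<in> J - I" for x
      using that no B unfolding indep_def by (metis insert_subset)
    then show ?thesis using B(2) by blast
  qed
  have "\<exists>B'. B' \<in> \<B> \<and> J \<subseteq> B'" using J unfolding indep_def by blast
  then obtain B' where B': "B' \<in> \<B>" "J \<subseteq> B'"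
    and least: "\<And>B2. B2 \<in> \<B> \<and> J \<subseteq> B2 \<Longrightarrow> card (B' - (J \<union> B)) \<le> card (B2 - (J \<union> B))"
    using ex_has_least_nat[of "\<lambda>B'. B' \<in> \<B> \<and> J \<subseteq> B'" _ "\<lambda>B'. card (B' - (J \<union> B))"] by blast
  have fin: "finite B" "finite B'" "finite I" "finite J"
    using M B B' I J by (auto intro: indep_finite basis_indep)
  have "B' - (J \<union> B) = {}"
  proof (rule ccontr)
    assume "B' - (J \<union> B) \<noteq> {}"
    then obtain x where x: "x \<in> B' - (J \<union> B)" by blast
    then obtain y where y: "y \<in> B - B'" "insert y (B' - {x}) \<in> \<B>"
      using M B B' unfolding matroid_def by blast
    have "insert y (B' - {x}) - (J \<union> B) = (B' - (J \<union> B)) - {x}" using y by auto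
    then have "card (insert y (B' - {x}) - (J \<union> B)) < card (B' - (J \<union> B))"
      using x fin by (metis card_Diff1_less finite_Diff)
    moreover have "J \<subseteq> insert y (B' - {x})" using B' x by blast
    ultimately show False using least y(2) by (meson not_le)
  qed
  then have B'_diff: "B' - B = J - I" using disj B'(2) by blast
  have "B - (I \<union> B') = {}"
  proof (rule ccontr)
    assume "B - (I \<union> B') \<noteq> {}"
    then obtain x where x: "x \<in> B - (I \<union> B')" by blast
    \<comment> \<open>The exchange keeps \<open>I\<close> inside the new basis, and \<open>y\<close>
      lies in \<open>B' - B = J - I\<close>, so \<open>y\<close> would augment
      \<open>I\<close>.\<close>
    then obtain y where y: "y \<in> B' - B" "insert y (B - {x}) \<in> \<B>"
      using M B B' unfolding matroid_def by blast
    have "insert y I \<subseteq> insert y (B - {x})" using B x by blast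
    then have "indep \<B> (insert y I)" using y(2) indep_def by blast
    then show False using no y(1) B'_diff by blast
  qed
  then have "B - B' \<subseteq> I - J" using B'(2) B(2) by blast
  then have "card (B - B') \<le> card (I - J)" using fin by (simp add: card_mono)
  moreover have "card (B - B') = card (B' - B)"
    using matroid_card_bases[OF M B(1) B'(1)] fin
    by (metis card_Diff_subset_Int card_Int_Diff Int_commute finite_Int)
  ultimately have "card (J - I) \<le> card (I - J)" using B'_diff by simp
  then show False using less fin
    by (metis Int_commute add_le_cancel_left card_Int_Diff not_le)
qed

section \<open>Rank, maximal independent subsets and closure\<close>

lemma rk_sets:
  assumes "matroid X \<B>"
  shows "finite {I. I \<subseteq> S \<and> indep \<B> I}" "indep \<B> {}"
proof -
  have "{I. I \<subseteq> S \<and> indep \<B> I} \<subseteq> Pow X" using indep_subset[OF assms] by blast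
  then show "finite {I. I \<subseteq> S \<and> indep \<B> I}"
    using assms unfolding matroid_def by (meson finite_Pow_iff finite_subset)
  show "indep \<B> {}" using assms unfolding matroid_def indep_def by auto
qed

lemma rk_ge:
  assumes "matroid X \<B>" "indep \<B> I" "I \<subseteq> S"
  shows "card I \<le> rk \<B> S"
  unfolding rk_def using assms rk_sets(1)[OF assms(1)] by (intro Max_ge) auto

lemma rk_obtain:
  assumes "matroid X \<B>"
  obtains I where "I \<subseteq> S" "indep \<B> I" "card I = rk \<B> S"
proof -
  have "rk \<B> S \<in> card ` {I. I \<subseteq> S \<and> indep \<B> I}"
    unfolding rk_def using rk_sets[OF assms] by (intro Max_in) auto
  then obtain I where "rk \<B> S = card I" "I \<subseteq> S \<and> indep \<B> I" by blast
  then show ?thesis using that[of I] by simp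
qed

lemma indep_extend:
  assumes M: "matroid X \<B>" and "indep \<B> I" "I \<subseteq> S"
  obtains J where "I \<subseteq> J" "J \<subseteq> S" "indep \<B> J" "card J = rk \<B> S"
proof -
  have "\<exists>J. I \<subseteq> J \<and> J \<subseteq> S \<and> indep \<B> J \<and> card J = rk \<B> S"
    using assms(2,3)
  proof (induction "rk \<B> S - card I" arbitrary: I)
    case 0
    then show ?case using rk_ge[OF M 0(2,3)] by (intro exI[of _ I]) auto
  next
    case (Suc k)
    obtain K where K: "K \<subseteq> S" "indep \<B> K" "card K = rk \<B> S" using rk_obtain[OF M] .
    moreover have "card I < card K" using Suc(2) K(3) by simp
    ultimately obtain x where x: "x \<in> K - I" "indep \<B> (insert x I)"
      using indep_augment[OF M Suc(3) K(2)] by blast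
    have "card (insert x I) = Suc (card I)" using x indep_finite[OF M Suc(3)] by simp
    moreover have "insert x I \<subseteq> S" using x(1) K(1) Suc(4) by blast
    ultimately have "\<exists>J. insert x I \<subseteq> J \<and> J \<subseteq> S \<and> indep \<B> J \<and> card J = rk \<B> S"
      using Suc(2) x(2) by (intro Suc(1)) auto
    then show ?case by blast
  qed
  then obtain J where "I \<subseteq> J \<and> J \<subseteq> S \<and> indep \<B> J \<and> card J = rk \<B> S" by blast
  then show ?thesis using that[of J] by simp
qed

lemma rk_mono:
  assumes "matroid X \<B>" "S \<subseteq> T"
  shows "rk \<B> S \<le> rk \<B> T"
proof -
  obtain I where "I \<subseteq> S" "indep \<B> I" "card I = rk \<B> S" using rk_obtain[OF assms(1)] .
  then show ?thesis using rk_ge[OF assms(1), of I T] assms(2) by simp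
qed

lemma rk_insert_le:
  assumes "matroid X \<B>"
  shows "rk \<B> (insert x S) \<le> Suc (rk \<B> S)"
proof -
  obtain I where I: "I \<subseteq> insert x S" "indep \<B> I" "card I = rk \<B> (insert x S)"
    using rk_obtain[OF assms] .
  have "card (I - {x}) \<le> rk \<B> S"
    by (rule rk_ge[OF assms indep_mono[OF I(2)]]) (use I(1) in auto)
  then show ?thesis using I(3) card_Diff1_le[of I x] indep_finite[OF assms I(2)]
    by (cases "x \<in> I") auto
qed

text \<open>Membership of \<open>x\<close> in the closure of \<open>S\<close>.\<close>

definition spans :: "'a set set \<Rightarrow> 'a set \<Rightarrow> 'a \<Rightarrow> bool" where
  "spans \<B> S x \<longleftrightarrow> rk \<B> (insert x S) = rk \<B> S"

lemma spans_member: "x \<in> S \<Longrightarrow> spans \<B> S x"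
  by (simp add: spans_def insert_absorb)

lemma not_spans_rk:
  assumes "matroid X \<B>" "\<not> spans \<B> S x"
  shows "rk \<B> (insert x S) = Suc (rk \<B> S)"
  using rk_insert_le[OF assms(1), of x S] rk_mono[OF assms(1) subset_insertI, of S x] assms(2)
  unfolding spans_def by linarith

text \<open>A maximal independent extension of \<open>I\<close> in \<open>insert x S\<close> has one
  element more than \<open>I\<close>; this exceeds the rank of \<open>S\<close>, so the extension
  contains \<open>x\<close>.\<close>

lemma not_spans_indep:
  assumes M: "matroid X \<B>" and I: "indep \<B> I" "I \<subseteq> S" "card I = rk \<B> S" and x: "\<not> spans \<B> S x"
  shows "indep \<B> (insert x I)"
proof -
  obtain J where J: "I \<subseteq> J" "J \<subseteq> insert x S" "indep \<B> J" "card J = rk \<B> (insert x S)"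
    using indep_extend[OF M I(1), of "insert x S"] I(2) by blast
  have card: "card J = Suc (card I)" using J(4) I(3) not_spans_rk[OF M x] by simp
  have "x \<in> J"
  proof (rule ccontr)
    assume "x \<notin> J"
    then have "J \<subseteq> S" using J(2) by blast
    then show False using rk_ge[OF M J(3), of S] card I(3) by simp
  qed
  then have "insert x I \<subseteq> J" using J(1) by blast
  then show ?thesis using indep_mono[OF J(3)] by blast
qed

text \<open>If \<open>T\<close> does not span \<open>x\<close>, then \<open>x\<close> can be added
  to a maximal independent subset of \<open>T\<close> that extends one of \<open>S\<close>, hence
  also to the latter.\<close>

lemma spans_mono:
  assumes M: "matroid X \<B>" and "S \<subseteq> T" "spans \<B> S x"
  shows "spans \<B> T x"
proof (rule ccontr)
  assume no: "\<not> spans \<B> T x"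
  obtain I where I: "I \<subseteq> S" "indep \<B> I" "card I = rk \<B> S" using rk_obtain[OF M] .
  obtain J where J: "I \<subseteq> J" "J \<subseteq> T" "indep \<B> J" "card J = rk \<B> T"
    using indep_extend[OF M I(2), of T] I(1) assms(2) by blast
  have "indep \<B> (insert x J)" by (rule not_spans_indep[OF M J(3,2,4) no])
  then have "indep \<B> (insert x I)" using indep_mono J(1) by (metis insert_mono)
  then have "card (insert x I) \<le> rk \<B> (insert x S)" using rk_ge[OF M] I(1) by (metis insert_mono)
  moreover have "x \<notin> I" using no I(1) assms(2) spans_member[of x T] by blast
  ultimately show False using I(3) assms(3) indep_finite[OF M I(2)] unfolding spans_def by simp
qed

text \<open>The exchange property of closure: adding \<open>x\<close>, \<open>y\<close> or both to
  \<open>F\<close> always gives rank \<open>rk \<B> F + 1\<close>.\<close>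

lemma spans_exchange:
  assumes M: "matroid X \<B>" and "\<not> spans \<B> F x" "spans \<B> (insert y F) x"
  shows "\<not> spans \<B> F y" "spans \<B> (insert x F) y"
proof -
  have rx: "rk \<B> (insert x F) = Suc (rk \<B> F)" using not_spans_rk[OF M assms(2)] .
  have rxy: "rk \<B> (insert x (insert y F)) = rk \<B> (insert y F)" using assms(3) unfolding spans_def .
  have "rk \<B> (insert x F) \<le> rk \<B> (insert x (insert y F))" by (rule rk_mono[OF M]) auto
  then have *: "rk \<B> (insert y F) = Suc (rk \<B> F)" using rx rxy rk_insert_le[OF M, of y F] by simp
  then show "\<not> spans \<B> F y" unfolding spans_def by simp
  show "spans \<B> (insert x F) y" using rx rxy * by (simp add: spans_def insert_commute[of y x])
qed

text \<open>Transitivity of parallelism over \<open>F\<close>, through \<open>s\<close>: adding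
  \<open>x\<close>, \<open>s\<close> and \<open>y\<close> together raises the rank by only
  one.\<close>

lemma spans_parallel:
  assumes M: "matroid X \<B>" and s: "\<not> spans \<B> F s" "spans \<B> (insert x F) s" "spans \<B> (insert y F) s"
  shows "\<not> spans \<B> F x" "\<not> spans \<B> F y" "spans \<B> (insert x F) y"
proof -
  note x = spans_exchange[OF M s(1,2)] and y = spans_exchange[OF M s(1,3)]
  show "\<not> spans \<B> F x" "\<not> spans \<B> F y" by (rule x(1), rule y(1))
  have "spans \<B> (insert x (insert s F)) y" by (rule spans_mono[OF M _ y(2)]) auto
  then have "rk \<B> (insert y (insert x (insert s F))) = Suc (rk \<B> F)"
    using x(2) not_spans_rk[OF M s(1)] unfolding spans_def by simp
  moreover have "rk \<B> (insert y (insert x F)) \<le> rk \<B> (insert y (insert x (insert s F)))"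
    by (rule rk_mono[OF M]) auto
  moreover have "rk \<B> (insert x F) \<le> rk \<B> (insert y (insert x F))" by (rule rk_mono[OF M]) auto
  ultimately show "spans \<B> (insert x F) y"
    using not_spans_rk[OF M x(1)] unfolding spans_def by simp
qed

text \<open>\<open>K\<close> and \<open>K'\<close> are both maximal independent in \<open>G\<close>.
  Extending \<open>K'\<close> to the size of a basis inside \<open>K' \<union> K \<union> R\<close>
  cannot pick up further elements of \<open>G\<close>, so it adds exactly \<open>R\<close>.\<close>

lemma basis_swap:
  assumes M: "matroid X \<B>" and KR: "K \<union> R \<in> \<B>" and K: "K \<subseteq> G" "card K = rk \<B> G" "K \<inter> R = {}"
    and K': "indep \<B> K'" "K' \<subseteq> G" "card K' = rk \<B> G"
  shows "K' \<union> R \<in> \<B>"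
proof -
  have fin: "finite K" "finite R" using indep_finite[OF M basis_indep[OF KR]] by auto
  obtain J where J: "K' \<subseteq> J" "J \<subseteq> K' \<union> (K \<union> R)" "indep \<B> J" "card J = rk \<B> (K' \<union> (K \<union> R))"
    using indep_extend[OF M K'(1), of "K' \<union> (K \<union> R)"] by blast
  have finJ: "finite J" by (rule indep_finite[OF M J(3)])
  have ge: "card (K \<union> R) \<le> card J" unfolding J(4) by (rule rk_ge[OF M basis_indep[OF KR]]) auto
  have "card (J \<inter> G) \<le> card K'"
    unfolding K'(3) by (rule rk_ge[OF M indep_mono[OF J(3)]]) auto
  then have "J \<inter> G = K'" using card_seteq[of "J \<inter> G" K'] finJ J(1) K'(2) by auto
  then have "J \<subseteq> K' \<union> R" using J(2) K(1) by blast
  moreover have "card (K' \<union> R) \<le> card J"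
  proof -
    have "card (K' \<union> R) \<le> card K' + card R" by (rule card_Un_le)
    also have "\<dots> = card (K \<union> R)" using K K'(3) fin by (simp add: card_Un_disjoint)
    finally show ?thesis using ge by simp
  qed
  moreover have "finite (K' \<union> R)" using fin indep_finite[OF M K'(1)] by simp
  ultimately have "J = K' \<union> R" using card_seteq by blast
  moreover have "J \<in> \<B>" by (rule indep_card_basis[OF M J(3) KR ge])
  ultimately show ?thesis by simp
qed

text \<open>In the contraction by \<open>S\<close>, which has rank two, \<open>s\<close> is parallel to \<open>f\<close>, and
  neither of them is parallel to \<open>x\<close> or \<open>y\<close>.\<close>

lemma spans_crossing_bases:
  assumes M: "matroid X \<B>" and s: "indep \<B> {s}" "s \<notin> F" "spans \<B> F s"
    and x: "\<not> spans \<B> F x" and y: "\<not> spans \<B> F y" "spans \<B> (insert x F) y"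
  obtains f S where "f \<in> F" "S \<inter> {x, y, s, f} = {}"
    "insert x (insert s S) \<in> \<B>" "insert x (insert f S) \<in> \<B>"
    "insert y (insert s S) \<in> \<B>" "insert y (insert f S) \<in> \<B>" "insert s (insert f S) \<notin> \<B>"
proof -
  let ?r = "rk \<B> F" and ?G = "insert y (insert x (insert s F))"
  have rs: "rk \<B> (insert s F) = ?r" using s(3) unfolding spans_def .
  \<comment> \<open>Adding \<open>s\<close>, which \<open>F\<close> spans, does not enlarge the
    closure.\<close>
  have nsp: "\<not> spans \<B> (insert s F) z" if "\<not> spans \<B> F z" for z
  proof -
    have "rk \<B> (insert z F) \<le> rk \<B> (insert z (insert s F))" by (rule rk_mono[OF M]) auto
    then show ?thesis unfolding spans_def rs using not_spans_rk[OF M that] by simp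
  qed
  have rG: "rk \<B> ?G = Suc ?r"
  proof -
    have "spans \<B> (insert x (insert s F)) y" by (rule spans_mono[OF M _ y(2)]) auto
    then show ?thesis
      using not_spans_rk[OF M nsp[OF x]] rs unfolding spans_def by simp
  qed
  obtain I where I: "I \<subseteq> F" "indep \<B> I" "card I = ?r" using rk_obtain[OF M] .
  have finI: "finite I" by (rule indep_finite[OF M I(2)])
  have sI: "\<not> indep \<B> (insert s I)"
  proof
    assume "indep \<B> (insert s I)"
    then have "card (insert s I) \<le> ?r" using rk_ge[OF M, of "insert s I" "insert s F"] I(1) rs by auto
    moreover have "s \<notin> I" using I(1) s(2) by blast
    ultimately show False using I(3) finI by simp
  qed
  \<comment> \<open>Since \<open>s\<close> is not a loop, \<open>{s}\<close> extends to a maximal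
    independent subset of \<open>insert s F\<close> inside \<open>insert s I\<close>.\<close>
  obtain J where J: "s \<in> J" "J \<subseteq> insert s I" "indep \<B> J" "card J = ?r"
  proof -
    obtain J where J: "{s} \<subseteq> J" "J \<subseteq> insert s I" "indep \<B> J" "card J = rk \<B> (insert s I)"
      using indep_extend[OF M s(1), of "insert s I"] by auto
    have "rk \<B> (insert s I) \<le> ?r" using rk_mono[OF M, of "insert s I" "insert s F"] I(1) rs by auto
    moreover have "?r \<le> rk \<B> (insert s I)" using rk_ge[OF M I(2), of "insert s I"] I(3) by auto
    ultimately show ?thesis using J that by auto
  qed
  \<comment> \<open>\<open>f\<close> is the element of \<open>I\<close> that \<open>s\<close>
    replaces, so \<open>s\<close> and \<open>f\<close> are parallel over
    \<open>I - {f}\<close>.\<close>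
  obtain f where f: "f \<in> I" "f \<notin> J" 
  proof -
    have "\<not> insert s I \<subseteq> J" using indep_mono[OF J(3)] sI by blast
    then show ?thesis using that J(1) by blast
  qed
  have J_eq: "J = insert s (I - {f})"
  proof (rule card_seteq)
    show "J \<subseteq> insert s (I - {f})" using J f by blast
    have "card (insert s (I - {f})) = Suc (card (I - {f}))" using finI s(2) I(1) by (subst card_insert_disjoint) auto
    also have "\<dots> = card J" using I(3) J(4) f(1) finI card_Suc_Diff1[of I f] by simp
    finally show "card (insert s (I - {f})) \<le> card J" by simp
  qed (use finI in simp)
  have notin: "x \<notin> insert s F" "y \<notin> insert s F"
    using nsp[OF x] nsp[OF y(1)] spans_member[of _ "insert s F"] by auto
  have Iz: "indep \<B> (insert z I)" "indep \<B> (insert z J)" "card (insert z I) = rk \<B> ?G"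
    "card (insert z J) = rk \<B> ?G" if "z \<in> {x, y}" for z
  proof -
    have z: "\<not> spans \<B> F z" "z \<notin> insert s F" using that x y(1) notin by auto
    show "indep \<B> (insert z I)" by (rule not_spans_indep[OF M I(2,1,3) z(1)])
    show "indep \<B> (insert z J)"
      by (rule not_spans_indep[OF M J(3) _ _ nsp[OF z(1)]]) (use J I rs in auto)
    show "card (insert z I) = rk \<B> ?G" unfolding rG using z I finI by (subst card_insert_disjoint) auto
    show "card (insert z J) = rk \<B> ?G"
      unfolding rG using z J I finI finite_subset[OF J(2)] by (subst card_insert_disjoint) auto
  qed
  obtain B where B: "B \<in> \<B>" "insert x I \<subseteq> B" using Iz(1)[of x] unfolding indep_def by auto
  define R where "R = B - insert x I"
  have RG: "R \<inter> ?G = {}"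
  proof (rule ccontr)
    assume "R \<inter> ?G \<noteq> {}"
    then obtain z where z: "z \<in> B" "z \<notin> insert x I" "z \<in> ?G" unfolding R_def by blast
    have "indep \<B> (insert z (insert x I))" using indep_mono[OF basis_indep[OF B(1)]] B(2) z(1) by simp
    then have "card (insert z (insert x I)) \<le> rk \<B> ?G" using rk_ge[OF M, of _ ?G] z(3) I(1) by blast
    moreover have "card (insert z (insert x I)) = Suc (card (insert x I))" using z(2) finI by simp
    ultimately show False using Iz(3)[of x] by simp
  qed
  \<comment> \<open>\<open>R\<close> lies outside \<open>?G\<close> and completes
    \<open>insert x I\<close> to a basis. The sets \<open>insert z I\<close> and
    \<open>insert z J\<close>, for \<open>z\<close> equal to \<open>x\<close> or \<open>y\<close>,
    are maximal independent in \<open>?G\<close> too, so the same \<open>R\<close> completes all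
    four.\<close>
  have KR: "insert x I \<union> R \<in> \<B>" using B unfolding R_def by (metis Diff_partition)
  have swap: "K' \<union> R \<in> \<B>" if "indep \<B> K'" "K' \<subseteq> ?G" "card K' = rk \<B> ?G" for K'
    by (rule basis_swap[OF M KR _ Iz(3) _ that]) (use I(1) in \<open>auto simp: R_def\<close>)
  define S where "S = (I - {f}) \<union> R"
  have I_eq: "insert z I \<union> R = insert z (insert f S)" and J_eq': "insert z J \<union> R = insert z (insert s S)" for z
    unfolding S_def J_eq using f(1) by auto
  have bases: "insert z (insert f S) \<in> \<B>" "insert z (insert s S) \<in> \<B>" if "z \<in> {x, y}" for z
    unfolding I_eq[symmetric] J_eq'[symmetric] using that I(1) J(2) Iz[OF that]
    by (intro swap; blast)+
  have "insert s (insert f S) \<notin> \<B>"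
  proof
    assume "insert s (insert f S) \<in> \<B>"
    then have "indep \<B> (insert s I)"
      by (rule indep_mono[OF basis_indep]) (auto simp: S_def)
    then show False using sI by simp
  qed
  moreover have "S \<inter> {x, y, s, f} = {}"
    using RG I(1) f(1) notin s(2) unfolding S_def by blast
  ultimately show ?thesis using that[of f S] bases f(1) I(1) by blast
qed

section \<open>Cyclic intervals and arrows\<close>

definition cyc_pred :: "nat \<Rightarrow> nat \<Rightarrow> nat" where
  "cyc_pred n i = (if i = 1 then n else i - 1)"

lemma cyc_succ_mem: "i \<in> {1..n} \<Longrightarrow> cyc_succ n i \<in> {1..n}"
  by (auto simp: cyc_succ_def)

lemma cyc_pred_mem: "i \<in> {1..n} \<Longrightarrow> cyc_pred n i \<in> {1..n}"
  by (auto simp: cyc_pred_def)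

lemma cyc_pos_eq:
  assumes "a \<in> {1..n}" "x \<in> {1..n}"
  shows "cyc_pos n a x = (if a \<le> x then x - a else x + n - a)"
proof (cases "a \<le> x")
  case True
  then have "x + n - a = (x - a) + n" by simp
  moreover have "x - a < n" using assms by auto
  ultimately show ?thesis using True by (simp only: cyc_pos_def mod_add_self2 mod_less if_True)
next
  case False
  then show ?thesis using assms by (auto simp: cyc_pos_def)
qed

lemma cyc_interval_eq:
  assumes "a \<in> {1..n}" "b \<in> {1..n}"
  shows "cyc_interval n a b = (if a \<le> b then {a..b} else {a..n} \<union> {1..b})"
proof (rule Set.set_eqI)
  fix x
  show "x \<in> cyc_interval n a b \<longleftrightarrow> x \<in> (if a \<le> b then {a..b} else {a..n} \<union> {1..b})"
  proof (cases "x \<in> {1..n}")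
    case True
    then show ?thesis using assms
      by (auto simp: cyc_interval_def cyc_le_def cyc_pos_eq[OF assms(1) True] cyc_pos_eq[OF assms])
  next
    case False
    then show ?thesis using assms by (auto simp: cyc_interval_def)
  qed
qed

text \<open>Translates the two intervals compared by \<open>decorated_perm\<close> at
  \<open>y\<close> into the complement of the arrow from \<open>x\<close> to
  \<open>y\<close>.\<close>

lemma cyc_interval_gap:
  assumes "x \<in> {1..n}" "y \<in> {1..n}" "x \<noteq> y"
  shows "cyc_interval n (cyc_succ n y) x = insert x ({1..n} - cyc_interval n x y)"
    and "cyc_interval n y x = insert y (insert x ({1..n} - cyc_interval n x y))"
proof -
  note eqs = cyc_interval_eq[OF assms(1,2)] cyc_interval_eq[OF assms(2,1)]
    cyc_interval_eq[OF cyc_succ_mem[OF assms(2)] assms(1)]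
  show "cyc_interval n (cyc_succ n y) x = insert x ({1..n} - cyc_interval n x y)"
    unfolding eqs using assms by (auto simp: cyc_succ_def)
  show "cyc_interval n y x = insert y (insert x ({1..n} - cyc_interval n x y))"
    unfolding eqs using assms by auto
qed

text \<open>Lengthening the arrow by one step takes one element from its complement, unless the
  arrow is already the whole cycle. This drives the maximality argument in
  \<open>decorated_perm_onto\<close>.\<close>

lemma cyc_interval_gap_succ:
  assumes "x \<in> {1..n}" "y \<in> {1..n}" "x \<noteq> y"
  shows "{1..n} - cyc_interval n x y =
    (if cyc_succ n y = x then {}
     else insert (cyc_succ n y) ({1..n} - cyc_interval n x (cyc_succ n y)))"
  unfolding cyc_interval_eq[OF assms(1,2)] cyc_interval_eq[OF assms(1) cyc_succ_mem[OF assms(2)]]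
  using assms by (auto simp: cyc_succ_def)

text \<open>If \<open>j\<close> comes before \<open>x\<close> on the way from \<open>y\<close>, then
  the elements after \<open>y\<close> up to \<open>j\<close> lie strictly between \<open>y\<close>
  and \<open>x\<close>.\<close>

lemma cyc_interval_gap_mono:
  assumes "x \<in> {1..n}" "y \<in> {1..n}" "j \<in> {1..n}" "j \<noteq> y" "cyc_pos n y j < cyc_pos n y x"
  shows "insert j ({1..n} - cyc_interval n j y) \<subseteq> {1..n} - cyc_interval n x y"
  using assms(4,5)
  unfolding cyc_interval_eq[OF assms(1,2)] cyc_interval_eq[OF assms(3,2)]
    cyc_pos_eq[OF assms(2,3)] cyc_pos_eq[OF assms(2,1)]
  using assms(1-3) by (auto split: if_splits)

lemma cyc_interval_punctured:
  assumes "x \<in> {1..n}" "2 \<le> n"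
  shows "{1..n} - cyc_interval n x (cyc_succ n x) = {1..n} - {x, cyc_succ n x}"
  unfolding cyc_interval_eq[OF assms(1) cyc_succ_mem[OF assms(1)]]
  using assms by (auto simp: cyc_succ_def)

text \<open>Both neighbours of a proper cyclic interval extend it to a cyclic interval, and its
  complement runs from one neighbour to the other.\<close>

lemma cyc_interval_extend:
  assumes "p \<in> {1..n}" "q \<in> {1..n}" "cyc_interval n p q \<noteq> {1..n}"
  shows "cyc_interval n p (cyc_succ n q) = insert (cyc_succ n q) (cyc_interval n p q)"
    and "cyc_interval n (cyc_pred n p) q = insert (cyc_pred n p) (cyc_interval n p q)"
    and "{1..n} - cyc_interval n (cyc_succ n q) (cyc_pred n p) = cyc_interval n p q"
    and "cyc_succ n q \<notin> cyc_interval n p q" "cyc_pred n p \<notin> cyc_interval n p q"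
proof -
  note eqs = cyc_interval_eq[OF assms(1,2)] cyc_interval_eq[OF assms(1) cyc_succ_mem[OF assms(2)]]
    cyc_interval_eq[OF cyc_pred_mem[OF assms(1)] assms(2)]
    cyc_interval_eq[OF cyc_succ_mem[OF assms(2)] cyc_pred_mem[OF assms(1)]]
  \<comment> \<open>These are the two ways to write the whole cycle, without and with
    wrap-around.\<close>
  have ne: "\<not> (p = 1 \<and> q = n)" "p \<noteq> Suc q"
    using assms(3) assms(1,2) unfolding eqs by (auto split: if_splits)
  show "cyc_interval n p (cyc_succ n q) = insert (cyc_succ n q) (cyc_interval n p q)"
    unfolding eqs using assms(1,2) ne by (auto simp: cyc_succ_def)
  show "cyc_interval n (cyc_pred n p) q = insert (cyc_pred n p) (cyc_interval n p q)"
    unfolding eqs using assms(1,2) ne by (auto simp: cyc_pred_def)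
  show "{1..n} - cyc_interval n (cyc_succ n q) (cyc_pred n p) = cyc_interval n p q"
    unfolding eqs using assms(1,2) ne by (auto simp: cyc_pred_def cyc_succ_def)
  show "cyc_succ n q \<notin> cyc_interval n p q" "cyc_pred n p \<notin> cyc_interval n p q"
    unfolding eqs using assms(1,2) ne by (auto simp: cyc_pred_def cyc_succ_def)
qed

section \<open>Loops, coloops and the decorated permutation\<close>

lemma loopless_not_spans_empty:
  assumes M: "matroid X \<B>" and "loopless X \<B>" "x \<in> X"
  shows "indep \<B> {x}" "\<not> spans \<B> {} x"
proof -
  show ind: "indep \<B> {x}" using assms(2,3) unfolding loopless_def indep_def by auto
  obtain I where "I \<subseteq> {}" "indep \<B> I" "card I = rk \<B> {}" using rk_obtain[OF M] .
  then have "rk \<B> {} = 0" by simp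
  then show "\<not> spans \<B> {} x" using rk_ge[OF M ind, of "{x}"] unfolding spans_def by simp
qed

text \<open>A basis avoiding \<open>x\<close> shows that \<open>X - {x}\<close> has full
  rank.\<close>

lemma coloopless_spans:
  assumes M: "matroid X \<B>" and "coloopless X \<B>" "x \<in> X"
  shows "spans \<B> (X - {x}) x"
proof -
  obtain B where B: "B \<in> \<B>" "x \<notin> B" using assms(2,3) unfolding coloopless_def by auto
  have ind: "indep \<B> B" by (rule basis_indep[OF B(1)])
  obtain I where I: "I \<subseteq> insert x (X - {x})" "indep \<B> I" "card I = rk \<B> (insert x (X - {x}))"
    using rk_obtain[OF M] .
  obtain B' where B': "B' \<in> \<B>" "I \<subseteq> B'" using I(2) unfolding indep_def by auto
  have "card I \<le> card B'" using B' indep_finite[OF M basis_indep[OF B'(1)]] by (simp add: card_mono)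
  also have "\<dots> = card B" by (rule matroid_card_bases[OF M B'(1) B(1)])
  also have "\<dots> \<le> rk \<B> (X - {x})"
    using rk_ge[OF M ind, of "X - {x}"] indep_subset[OF M ind] B(2) by auto
  finally show ?thesis using rk_mono[OF M subset_insertI, of "X - {x}" x] I(3)
    unfolding spans_def by linarith
qed

lemma loopless_coloopless_card:
  fixes n x :: nat
  assumes M: "matroid {1..n} \<B>" and "loopless {1..n} \<B>" "coloopless {1..n} \<B>" "x \<in> {1..n}"
  shows "2 \<le> n"
proof (rule ccontr)
  assume "\<not> 2 \<le> n"
  then have eq: "{1..n} - {x} = {}" using assms(4) by auto
  show False
    using coloopless_spans[OF M assms(3,4)] loopless_not_spans_empty(2)[OF M assms(2,4)]
    unfolding eq by simp
qed

text \<open>The rank condition at \<open>j\<close> says that the elements after \<open>y\<close> up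
  to \<open>j\<close> span \<open>y\<close>. It holds at \<open>x\<close>; at an earlier
  \<open>j\<close> it would make the complement of the arrow span \<open>y\<close>.\<close>

lemma decorated_perm_eqI:
  assumes M: "matroid {1..n} \<B>" and x: "x \<in> {1..n}" and y: "y \<in> {1..n}" and "x \<noteq> y"
    and nsp: "\<not> spans \<B> ({1..n} - cyc_interval n x y) y"
    and sp: "spans \<B> (insert x ({1..n} - cyc_interval n x y)) y"
  shows "decorated_perm n \<B> y = x"
proof -
  define P where "P j \<longleftrightarrow> j \<in> {1..n} - {y} \<and>
    rk \<B> (cyc_interval n y j) = rk \<B> (cyc_interval n (cyc_succ n y) j)" for j
  have P: "P j \<longleftrightarrow> j \<in> {1..n} - {y} \<and> spans \<B> (insert j ({1..n} - cyc_interval n j y)) y" for j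
    unfolding P_def spans_def using cyc_interval_gap[of j n y] y by auto
  have Px: "P x" unfolding P using assms by simp
  have min: "cyc_pos n y x \<le> cyc_pos n y j" if "P j" for j
  proof (rule ccontr)
    assume "\<not> ?thesis"
    then have "insert j ({1..n} - cyc_interval n j y) \<subseteq> {1..n} - cyc_interval n x y"
      using that by (intro cyc_interval_gap_mono[OF x y]) (auto simp: P_def)
    then show False using spans_mono[OF M] that nsp unfolding P by blast
  qed
  let ?k = "arg_min (cyc_pos n y) P"
  have k: "P ?k" "cyc_pos n y ?k \<le> cyc_pos n y x"
    using arg_min_natI[of P x] arg_min_nat_le[of P x] Px by auto
  have kn: "?k \<in> {1..n}" using k(1) unfolding P_def by simp
  \<comment> \<open>\<open>arg_min\<close> returns some minimizer; it is \<open>x\<close> because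
    positions are injective.\<close>
  have "cyc_pos n y ?k = cyc_pos n y x" using k min[OF k(1)] by simp
  then have "?k = x"
    unfolding cyc_pos_eq[OF y kn] cyc_pos_eq[OF y x] using x y kn by (auto split: if_splits)
  then show ?thesis using y unfolding decorated_perm_def P_def[abs_def] by simp
qed

text \<open>Let \<open>y\<close> be the last element after \<open>x\<close> for which the complement
  of \<open>[x, y]\<close> together with \<open>y\<close> spans \<open>x\<close>. By maximality the
  complement alone does not span \<open>x\<close>, so \<open>x\<close> and \<open>y\<close> are
  parallel over it.\<close>

lemma decorated_perm_onto:
  assumes M: "matroid {1..n} \<B>" and ll: "loopless {1..n} \<B>" and cl: "coloopless {1..n} \<B>"
    and x: "x \<in> {1..n}"
  obtains y where "y \<in> {1..n}" "y \<noteq> x" "decorated_perm n \<B> y = x"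
    "\<not> spans \<B> ({1..n} - cyc_interval n x y) x" "\<not> spans \<B> ({1..n} - cyc_interval n x y) y"
    "spans \<B> (insert x ({1..n} - cyc_interval n x y)) y"
proof -
  let ?gap = "\<lambda>y. {1..n} - cyc_interval n x y"
  define Q where "Q y \<longleftrightarrow> y \<in> {1..n} \<and> y \<noteq> x \<and> spans \<B> (insert y (?gap y)) x" for y
  have n: "2 \<le> n" by (rule loopless_coloopless_card[OF M ll cl x])
  have succ_ne: "cyc_succ n x \<noteq> x" using n by (auto simp: cyc_succ_def)
  \<comment> \<open>The successor of \<open>x\<close> is a candidate, because \<open>x\<close> is
    not a coloop.\<close>
  have "insert (cyc_succ n x) (?gap (cyc_succ n x)) = {1..n} - {x}"
    unfolding cyc_interval_punctured[OF x n] using cyc_succ_mem[OF x] succ_ne by auto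
  then have "Q (cyc_succ n x)"
    unfolding Q_def using cyc_succ_mem[OF x] succ_ne coloopless_spans[OF M cl x] by simp
  moreover have "\<forall>y. Q y \<longrightarrow> cyc_pos n x y < n" using n by (simp add: cyc_pos_def)
  ultimately obtain y where y: "Q y" and max: "\<And>z. Q z \<Longrightarrow> cyc_pos n x z \<le> cyc_pos n x y"
    using ex_has_greatest_nat[of Q _ "cyc_pos n x" n] by blast
  have yn: "y \<in> {1..n}" "y \<noteq> x" and sp: "spans \<B> (insert y (?gap y)) x" using y unfolding Q_def by auto
  \<comment> \<open>Otherwise the successor of \<open>y\<close> would be a later candidate, or the
    complement would be empty and \<open>x\<close> a loop.\<close>
  have nsp: "\<not> spans \<B> (?gap y) x"
  proof
    assume spy: "spans \<B> (?gap y) x"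
    have gap: "?gap y = (if cyc_succ n y = x then {} else insert (cyc_succ n y) (?gap (cyc_succ n y)))"
      by (rule cyc_interval_gap_succ[OF x yn(1) yn(2)[symmetric]])
    have ne: "cyc_succ n y \<noteq> x"
    proof
      assume "cyc_succ n y = x"
      then have eq: "?gap y = {}" using gap by simp
      show False using spy loopless_not_spans_empty(2)[OF M ll x] unfolding eq by simp
    qed
    then have "spans \<B> (insert (cyc_succ n y) (?gap (cyc_succ n y))) x"
      using gap spy by simp
    then have "cyc_pos n x (cyc_succ n y) \<le> cyc_pos n x y"
      using max ne cyc_succ_mem[OF yn(1)] unfolding Q_def by simp
    then show False
      unfolding cyc_pos_eq[OF x yn(1)] cyc_pos_eq[OF x cyc_succ_mem[OF yn(1)]]
      using ne x yn by (auto simp: cyc_succ_def split: if_splits)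
  qed
  note ex = spans_exchange[OF M nsp sp]
  show ?thesis
    using that[OF yn decorated_perm_eqI[OF M x yn(1) yn(2)[symmetric] ex] nsp ex] .
qed

text \<open>A count: every element of \<open>{1..n}\<close> is a value. Injectivity makes
  \<open>inv_into\<close> return the preimage found in the proofs.\<close>

lemma inj_on_decorated_perm:
  assumes "matroid {1..n} \<B>" "loopless {1..n} \<B>" "coloopless {1..n} \<B>"
  shows "inj_on (decorated_perm n \<B>) {1..n}"
proof (rule eq_card_imp_inj_on)
  have "{1..n} \<subseteq> decorated_perm n \<B> ` {1..n}"
  proof
    fix x assume "x \<in> {1..n}"
    then obtain y where "y \<in> {1..n}" "decorated_perm n \<B> y = x"
      using decorated_perm_onto[OF assms, of x] by metis
    then show "x \<in> decorated_perm n \<B> ` {1..n}" by blast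
  qed
  then have "card {1..n} \<le> card (decorated_perm n \<B> ` {1..n})" by (intro card_mono) auto
  then show "card (decorated_perm n \<B> ` {1..n}) = card {1..n}"
    using card_image_le[of "{1..n}" "decorated_perm n \<B>"] by simp
qed simp

section \<open>Flats and coverings by arrows\<close>

lemma flat_iff_not_spans:
  assumes "matroid X \<B>"
  shows "flat X \<B> F \<longleftrightarrow> F \<subseteq> X \<and> (\<forall>x\<in>X - F. \<not> spans \<B> F x)"
proof -
  have "rk \<B> F < rk \<B> (insert x F) \<longleftrightarrow> \<not> spans \<B> F x" for x
    using not_spans_rk[OF assms, of F x] by (auto simp: spans_def)
  then show ?thesis unfolding flat_def by simp
qed

lemma flat_imp_covered:
  assumes M: "matroid {1..n} \<B>" and ll: "loopless {1..n} \<B>" and cl: "coloopless {1..n} \<B>"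
    and E: "is_cyc_interval n E" and flat: "flat {1..n} \<B> E"
  shows "covered_by_ccw_arrows n (decorated_perm n \<B>) ({1..n} - E)"
  unfolding covered_by_ccw_arrows_def
proof
  fix s assume s: "s \<in> {1..n} - E"
  define Q where "Q F \<longleftrightarrow> is_cyc_interval n F \<and> E \<subseteq> F \<and> \<not> spans \<B> F s" for F
  have sub: "F \<subseteq> {1..n}" if "is_cyc_interval n F" for F
    using that unfolding is_cyc_interval_def cyc_interval_def by auto
  have QE: "Q E" unfolding Q_def using E flat s flat_iff_not_spans[OF M] by auto
  have "card F < Suc n" if "Q F" for F
    using card_mono[OF _ sub[of F]] that unfolding Q_def by auto
  then obtain F where F: "Q F" and max: "\<And>G. Q G \<Longrightarrow> card G \<le> card F"
    using ex_has_greatest_nat[of Q E card "Suc n"] QE by blast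
  obtain p q where p: "p \<in> {1..n}" and q: "q \<in> {1..n}" and Fpq: "F = cyc_interval n p q"
    using F unfolding Q_def is_cyc_interval_def by blast
  have nsp: "\<not> spans \<B> F s" and EF: "E \<subseteq> F" and Fn: "F \<subseteq> {1..n}"
    using F sub unfolding Q_def by auto
  have sF: "s \<notin> F" using nsp spans_member by metis
  have finF: "finite F" using Fn finite_subset by blast
  have ne: "cyc_interval n p q \<noteq> {1..n}" using sF s unfolding Fpq by auto
  define x y where "x = cyc_succ n q" and "y = cyc_pred n p"
  have x: "x \<in> {1..n}" and y: "y \<in> {1..n}"
    unfolding x_def y_def by (rule cyc_succ_mem[OF q], rule cyc_pred_mem[OF p])
  note extend = cyc_interval_extend[OF p q ne, folded x_def y_def Fpq]
  \<comment> \<open>A larger cyclic interval not spanning \<open>s\<close> would contradict the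
    choice of \<open>F\<close>.\<close>
  have spans_ext: "spans \<B> (insert z F) s" if "is_cyc_interval n (insert z F)" "z \<notin> F" for z
  proof (rule ccontr)
    assume "\<not> ?thesis"
    then have "Q (insert z F)" using that(1) EF unfolding Q_def by auto
    then show False using max[of "insert z F"] that(2) finF by simp
  qed
  have sp_x: "spans \<B> (insert x F) s"
    by (rule spans_ext[OF _ extend(4)]) (use p x extend(1)[symmetric] in \<open>unfold is_cyc_interval_def, blast\<close>)
  have sp_y: "spans \<B> (insert y F) s"
    by (rule spans_ext[OF _ extend(5)]) (use q y extend(2)[symmetric] in \<open>unfold is_cyc_interval_def, blast\<close>)
  \<comment> \<open>If \<open>F\<close> missed only one element, this would be \<open>s\<close>,
    which is not a coloop and hence spanned by \<open>F\<close>.\<close>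
  have "x \<noteq> y"
  proof
    assume "x = y"
    then have "{1..n} - {x} = F" using extend(3) x by (auto simp: cyc_interval_eq)
    then have "s = x" "F = {1..n} - {s}" using s sF by auto
    then show False using coloopless_spans[OF M cl] s nsp by auto
  qed
  note par = spans_parallel[OF M nsp sp_x sp_y]
  have "decorated_perm n \<B> y = x"
    by (rule decorated_perm_eqI[OF M x y \<open>x \<noteq> y\<close>]) (use par extend(3) in simp_all)
  then have "inv_into {1..n} (decorated_perm n \<B>) x = y"
    by (intro inv_into_f_eq[OF inj_on_decorated_perm[OF M ll cl] y])
  then have "ccw_arrow n (decorated_perm n \<B>) (cyc_interval n x y)"
    unfolding ccw_arrow_def using x by auto
  moreover have "cyc_interval n x y = {1..n} - F"
    unfolding extend(3)[symmetric] by (auto simp: cyc_interval_def)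
  ultimately show "\<exists>A. ccw_arrow n (decorated_perm n \<B>) A \<and> s \<in> A \<and> A \<subseteq> {1..n} - E"
    using s sF EF by auto
qed

text \<open>Positivity enters here: \<open>s\<close> lies on the arrow and \<open>f\<close> off it,
  so the chords \<open>{x, y}\<close> and \<open>{s, f}\<close> cross.\<close>

lemma positroid_arrow_not_spanned:
  assumes pos: "positroid n \<B>" and M: "matroid {1..n} \<B>" and ll: "loopless {1..n} \<B>"
    and x: "x \<in> {1..n}" "\<not> spans \<B> ({1..n} - cyc_interval n x y) x"
    and y: "y \<in> {1..n}" "\<not> spans \<B> ({1..n} - cyc_interval n x y) y"
    and xy: "x \<noteq> y" "spans \<B> (insert x ({1..n} - cyc_interval n x y)) y"
    and s: "s \<in> cyc_interval n x y"
  shows "\<not> spans \<B> ({1..n} - cyc_interval n x y) s"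
proof
  let ?F = "{1..n} - cyc_interval n x y"
  assume sp: "spans \<B> ?F s"
  have sn: "s \<in> {1..n}" using s unfolding cyc_interval_def by simp
  have s_ne: "s \<noteq> x" "s \<noteq> y" using sp x(2) y(2) by auto
  obtain f S where f: "f \<in> ?F" and S: "S \<inter> {x, y, s, f} = {}"
    and bases: "insert x (insert s S) \<in> \<B>" "insert x (insert f S) \<in> \<B>"
      "insert y (insert s S) \<in> \<B>" "insert y (insert f S) \<in> \<B>"
    and nb: "insert s (insert f S) \<notin> \<B>"
    by (rule spans_crossing_bases[OF M loopless_not_spans_empty(1)[OF M ll sn] _ sp x(2) y(2) xy(2)])
       (use s in blast)
  have "x \<in> cyc_interval n x y" "y \<in> cyc_interval n x y"
    unfolding cyc_interval_eq[OF x(1) y(1)] using x(1) y(1) by auto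
  then have "distinct [x, y, s, f]" using xy(1) s_ne s f by auto
  \<comment> \<open>Numerically, the arrow minus its ends is either the part between
    \<open>x\<close> and \<open>y\<close> or, if it wraps around, the part outside; \<open>f\<close>
    lies in the other part.\<close>
  moreover have "(min x y < s \<and> s < max x y) \<noteq> (min x y < f \<and> f < max x y)"
    using f s s_ne xy(1) unfolding cyc_interval_eq[OF x(1) y(1)]
    by (auto simp: min_def max_def split: if_splits)
  ultimately show False using positroid_crossing[OF pos _ S bases] nb by simp
qed

lemma positroid_covered_imp_flat:
  assumes pos: "positroid n \<B>" and ll: "loopless {1..n} \<B>" and cl: "coloopless {1..n} \<B>"
    and E: "E \<subseteq> {1..n}" and cov: "covered_by_ccw_arrows n (decorated_perm n \<B>) ({1..n} - E)"
  shows "flat {1..n} \<B> E"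
proof -
  have M: "matroid {1..n} \<B>" using pos unfolding positroid_def by simp
  have "\<not> spans \<B> E s" if s: "s \<in> {1..n} - E" for s
  proof
    assume sp: "spans \<B> E s"
    obtain x where x: "x \<in> {1..n}"
      and A: "s \<in> cyc_interval n x (inv_into {1..n} (decorated_perm n \<B>) x)"
        "cyc_interval n x (inv_into {1..n} (decorated_perm n \<B>) x) \<subseteq> {1..n} - E"
      using cov s unfolding covered_by_ccw_arrows_def ccw_arrow_def by blast
    obtain y where y: "y \<in> {1..n}" "y \<noteq> x" "decorated_perm n \<B> y = x"
      and nsp: "\<not> spans \<B> ({1..n} - cyc_interval n x y) x" "\<not> spans \<B> ({1..n} - cyc_interval n x y) y"
      and par: "spans \<B> (insert x ({1..n} - cyc_interval n x y)) y"
      using decorated_perm_onto[OF M ll cl x] .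
    have inv: "inv_into {1..n} (decorated_perm n \<B>) x = y"
      by (rule inv_into_f_eq[OF inj_on_decorated_perm[OF M ll cl] y(1,3)])
    \<comment> \<open>The complement of the arrow contains \<open>E\<close>, so by monotonicity it
      would span \<open>s\<close> as well.\<close>
    have "E \<subseteq> {1..n} - cyc_interval n x y" using A(2) E unfolding inv by blast
    then show False
      using spans_mono[OF M _ sp] A(1)[unfolded inv]
        positroid_arrow_not_spanned[OF pos M ll x nsp(1) y(1) nsp(2) y(2)[symmetric] par] by blast
  qed
  then show ?thesis using E flat_iff_not_spans[OF M] by simp
qed

theorem theorem4p2:
  fixes n :: nat and \<B> :: "nat set set" and \<pi> :: "nat \<Rightarrow> nat" and E :: "nat set"
  assumes "positroid n \<B>"
    and "loopless {1..n} \<B>" and "coloopless {1..n} \<B>"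
    and "\<pi> = decorated_perm n \<B>"
    and "is_cyc_interval n E"
  shows "flat {1..n} \<B> E \<longleftrightarrow> covered_by_ccw_arrows n \<pi> ({1..n} - E)"
proof -
  have "matroid {1..n} \<B>" using assms(1) unfolding positroid_def by simp
  moreover have "E \<subseteq> {1..n}" using assms(5) unfolding is_cyc_interval_def cyc_interval_def by auto
  ultimately show ?thesis
    using flat_imp_covered positroid_covered_imp_flat assms by metis
qed

end
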